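(* Let $(a_n)_{n\ge0}$ be the sequence, listed in increasing order, of the non-negative integers $m$ such that $240m+169$ is a perfect square. Then $$\sum_{n=0}^\infty(-1)^{\lfloor 5n/4\rfloor}q^{a_n}=\frac{(q^3,q^5,q^8;q^8)_\infty\,(q^2,q^{14};q^{16})_\infty}{(q^2,q^3;q^5)_\infty}.$$
   Context: Here $q$ is a complex number with $|q|<1$ (equivalently, the identity may be read as an identity of formal power series in $q$). For a complex number $a$, $(a;q)_\infty:=\prod_{i=0}^\infty(1-aq^i)$, and $(a_1,a_2,\dots,a_m;q)_\infty:=\prod_{j=1}^m(a_j;q)_\infty$. $\lfloor x\rfloor$ is the floor function. *)

theory Defs
  imports "HOL-Analysis.Analysis" "HOL-Library.Infinite_Set"
begin

definition qpoch_inf :: "complex \<Rightarrow> complex \<Rightarrow> complex" where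
  "qpoch_inf a q = (\<Prod>i. 1 - a * q ^ i)"

definition qpochs_inf :: "complex list \<Rightarrow> complex \<Rightarrow> complex" where
  "qpochs_inf as q = prod_list (map (\<lambda>a. qpoch_inf a q) as)"

definition square_idx :: "nat set" where
  "square_idx = {m. \<exists>k::nat. 240 * m + 169 = k ^ 2}"

definition a_seq :: "nat \<Rightarrow> nat" where
  "a_seq n = enumerate square_idx n"

text \<open>
  The next two facts show that the total functions above are not evaluated at junk values:
  the index set is infinite, as \<^const>\<open>enumerate\<close> requires, and the products converge.
\<close>

lemma infinite_square_idx: "infinite square_idx"
proof -
  have "inj (\<lambda>j::nat. 13 * j + 60 * j ^ 2)"
    by (rule strict_mono_imp_inj_on) (auto simp: strict_mono_def intro!: add_less_le_mono power_mono)
  moreover have "range (\<lambda>j::nat. 13 * j + 60 * j ^ 2) \<subseteq> square_idx"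
  proof (rule image_subsetI)
    fix j :: nat
    have "240 * (13 * j + 60 * j ^ 2) + 169 = (13 + 120 * j) ^ 2"
      by (simp add: power2_eq_square algebra_simps)
    then show "13 * j + 60 * j ^ 2 \<in> square_idx"
      unfolding square_idx_def by blast
  qed
  ultimately show ?thesis
    using finite_subset range_inj_infinite by blast
qed

lemma strict_mono_a_seq: "strict_mono a_seq"
  using strict_mono_enumerate[OF infinite_square_idx] by (simp add: strict_mono_def a_seq_def)

lemma range_a_seq: "range a_seq = square_idx"
  using range_enumerate[OF infinite_square_idx] by (simp add: a_seq_def)

lemma convergent_prod_qpoch:
  fixes a q :: complex
  assumes "norm q < 1"
  shows "convergent_prod (\<lambda>i. 1 - a * q ^ i)"
proof -
  have "summable (\<lambda>i. norm ((1 - a * q ^ i) - 1))"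
    using assms by (simp add: norm_mult norm_power summable_mult)
  then show ?thesis
    by (intro abs_convergent_prod_imp_convergent_prod summable_imp_abs_convergent_prod)
qed

end

theory Submission imports Defs begin

text \<open>
  Put \<open>q = x\<^sup>2\<close> and \<open>H(q) = 1 / (q\<^sup>2, q\<^sup>3; q\<^sup>5)\<^sub>\<infinity>\<close>. Rearranging factors gives
  \<open>(x\<^sup>2, x\<^sup>3, x\<^sup>5; x\<^sup>5)\<^sub>\<infinity> (x, x\<^sup>9; x\<^sup>1\<^sup>0)\<^sub>\<infinity> = (x; x)\<^sub>\<infinity> H(x\<^sup>2)\<close>. As \<open>H(x\<^sup>2)\<close> is even in \<open>x\<close>, the odd part of
  the left side is \<open>H(x\<^sup>2)\<close> times the odd part of \<open>(x; x)\<^sub>\<infinity>\<close>. By the quintuple product identity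
  (base \<open>x\<^sup>5\<close>) the former is \<open>-x\<close> times the sum of \<open>\<plusminus>q\<^sup>m\<close> over the squares \<open>k\<^sup>2 = 240 m + 169\<close>. By
  the pentagonal number theorem and the quintuple product identity (base \<open>q\<^sup>8\<close>) the odd part of
  \<open>(x; x)\<^sub>\<infinity>\<close> is \<open>-x (q\<^sup>3, q\<^sup>5, q\<^sup>8; q\<^sup>8)\<^sub>\<infinity> (q\<^sup>2, q\<^sup>1\<^sup>4; q\<^sup>1\<^sup>6)\<^sub>\<infinity>\<close>.
\<close>

subsection \<open>The Jacobi triple product\<close>

text \<open>Gaussian binomial coefficients through a q-Pascal recursion: polynomials in
  \<open>q\<close>, so no denominators arise and any commutative ring will do.\<close>

fun qbinom :: "'a::comm_ring_1 \<Rightarrow> nat \<Rightarrow> nat \<Rightarrow> 'a" where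
  "qbinom q n 0 = 1"
| "qbinom q 0 (Suc k) = 0"
| "qbinom q (Suc n) (Suc k) = qbinom q n k + q ^ Suc k * qbinom q n (Suc k)"

lemma qbinom_eq_0: "n < k \<Longrightarrow> qbinom q n k = 0"
  by (induction q n k rule: qbinom.induct) auto

text \<open>The q-binomial theorem. Splitting off the factor \<open>1 + y\<close> turns
  \<open>y\<close> into \<open>y * q\<close>, so the induction runs over all \<open>y\<close>; the
  two resulting sums merge by the recursion.\<close>

lemma qbinom_theorem:
  fixes q y :: "'a::comm_ring_1"
  shows "(\<Prod>k<n. 1 + y * q ^ k) = (\<Sum>k\<le>n. q ^ (k choose 2) * qbinom q n k * y ^ k)"
proof (induction n arbitrary: y)
  case 0
  then show ?case by (simp add: numeral_2_eq_2)
next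
  case (Suc n)
  let ?t = "\<lambda>k. q ^ (k choose 2) * qbinom q n k * (y * q) ^ k"
  have e: "Suc k choose 2 = k + (k choose 2)" for k
    by (simp add: numeral_2_eq_2)
  have "(\<Prod>k<Suc n. 1 + y * q ^ k) = (1 + y) * (\<Prod>k<n. 1 + (y * q) * q ^ k)"
    by (subst prod.lessThan_Suc_shift) (simp add: mult.assoc)
  also have "\<dots> = (\<Sum>k\<le>n. ?t k) + (\<Sum>k\<le>n. y * ?t k)"
    unfolding Suc.IH by (simp only: distrib_right sum_distrib_left mult_1 sum.distrib)
  also have "(\<Sum>k\<le>n. ?t k) = (\<Sum>k\<le>Suc n. ?t k)"
    by (simp add: qbinom_eq_0)
  also have "\<dots> = 1 + (\<Sum>k\<le>n. ?t (Suc k))"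
    by (subst sum.atMost_Suc_shift) (simp add: numeral_2_eq_2)
  also have "1 + (\<Sum>k\<le>n. ?t (Suc k)) + (\<Sum>k\<le>n. y * ?t k)
      = 1 + (\<Sum>k\<le>n. q ^ (Suc k choose 2) * qbinom q (Suc n) (Suc k) * y ^ Suc k)"
    unfolding add.assoc sum.distrib[symmetric]
    by (intro arg_cong2[where f = "(+)"] refl sum.cong)
       (simp_all add: e power_add power_mult_distrib algebra_simps)
  also have "\<dots> = (\<Sum>k\<le>Suc n. q ^ (k choose 2) * qbinom q (Suc n) k * y ^ k)"
    by (subst sum.atMost_Suc_shift) (simp add: numeral_2_eq_2)
  finally show ?case .
qed

text \<open>The quotient formula for Gaussian binomials with denominators cleared, hence valid even
  where some \<open>1 - q ^ i\<close> vanishes.\<close>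

lemma qbinom_mult_prod:
  fixes q :: "'a::comm_ring_1"
  assumes "k \<le> n"
  shows "qbinom q n k * (\<Prod>i<k. 1 - q ^ Suc i) * (\<Prod>i<n-k. 1 - q ^ Suc i) = (\<Prod>i<n. 1 - q ^ Suc i)"
  using assms
proof (induction n arbitrary: k)
  case 0
  then show ?case by simp
next
  case (Suc n)
  let ?P = "\<lambda>n. \<Prod>i<n. 1 - q ^ Suc i"
  show ?case
  proof (cases k)
    case 0
    then show ?thesis by simp
  next
    case (Suc j)
    with Suc.prems have j: "j \<le> n" by simp
    note IH1 = Suc.IH[OF j]
    show ?thesis
    proof (cases "j = n")
      case True
      then show ?thesis using IH1 Suc by (simp add: qbinom_eq_0 algebra_simps)
    next
      case False
      with j have jn: "Suc j \<le> n" by simp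
      define d where "d = n - Suc j"
      have n: "n = Suc (j + d)" and nj: "n - j = Suc d" using jn by (auto simp: d_def)
      have IH2: "qbinom q n (Suc j) * ?P (Suc j) * ?P d = ?P n"
        using Suc.IH[OF jn] by (simp add: d_def)
      \<comment> \<open>Each term of the recursion contains one induction hypothesis; the remaining
        weights telescope to \<open>1 - q ^ Suc n\<close>.\<close>
      have "qbinom q (Suc n) k * ?P k * ?P (Suc n - k)
        = (1 - q ^ Suc j) * (qbinom q n j * ?P j * ?P (n - j))
          + q ^ Suc j * (1 - q ^ Suc d) * (qbinom q n (Suc j) * ?P (Suc j) * ?P d)"
        using Suc by (simp add: nj algebra_simps)
      also have "\<dots> = ((1 - q ^ Suc j) + q ^ Suc j * (1 - q ^ Suc d)) * ?P n"
        unfolding IH1 IH2 by (simp only: ring_distribs)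
      also have "(1 - q ^ Suc j) + q ^ Suc j * (1 - q ^ Suc d) = 1 - q ^ Suc n"
        by (simp add: n algebra_simps power_add)
      also have "\<dots> * ?P n = ?P (Suc n)"
        by (simp add: mult.commute)
      finally show ?thesis .
    qed
  qed
qed

text \<open>One of two consecutive integers is even, so the division is exact. Exponent identities
  can thus be checked after doubling.\<close>

lemma twice_tri: "2 * (n * (n - 1) div 2) = n * (n - 1)" for n :: int
  by (rule dvd_mult_div_cancel) auto

lemma twice_pent: "2 * (n * (3 * n + 1) div 2) = n * (3 * n + 1)" for n :: int
  by (rule dvd_mult_div_cancel) auto

lemma twice_pent': "2 * (n * (3 * n - 1) div 2) = n * (3 * n - 1)" for n :: int
  by (rule dvd_mult_div_cancel) auto

lemma pent_eqI: "n * (3 * n + 1) = 2 * e \<Longrightarrow> n * (3 * n + 1) div 2 = e" for n e :: int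
  by simp

lemma int_choose_two: "int (n choose 2) = int n * (int n - 1) div 2"
proof -
  have "2 * (n choose 2) = n * (n - 1)"
    unfolding choose_two by (rule dvd_mult_div_cancel) auto
  then have "2 * int (n choose 2) = int n * (int n - 1)"
    by (metis (no_types, opaque_lifting) One_nat_def diff_zero int_ops(2) mult_eq_0_iff of_nat_diff of_nat_mult of_nat_numeral of_nat_0 Suc_leI bot_nat_0.not_eq_extremum)
  then show ?thesis by simp
qed

text \<open>This is the q-binomial theorem with \<open>2 * N\<close> factors at
  \<open>y = - z / q ^ N\<close>: the last \<open>N\<close> factors are
  \<open>1 - z * q ^ k\<close>, the first \<open>N\<close> are, in reverse order,
  \<open>1 - q / z * q ^ k\<close> up to monomials.\<close>

lemma finite_jacobi_triple_product:
  fixes q z :: complex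
  assumes "q \<noteq> 0" "z \<noteq> 0"
  shows "(\<Prod>k<N. 1 - z * q ^ k) * (\<Prod>k<N. 1 - q / z * q ^ k) =
    (\<Sum>n\<in>{-int N..int N}. (-1) powi n * q powi (n * (n - 1) div 2) * z powi n
        * qbinom q (2 * N) (nat (n + int N)))"
proof -
  define y where "y = - z / q ^ N"
  \<comment> \<open>\<open>C\<close> is the product of the monomials \<open>- z / q ^ Suc k\<close>
    pulled out of the first \<open>N\<close> factors.\<close>
  define C where "C = (-1) ^ N * z ^ N * q powi (- (int (Suc N) * int N div 2))"
  have C0: "C \<noteq> 0" using assms by (simp add: C_def)
  have "(\<Prod>k<N. 1 + y * q ^ k) = (\<Prod>k<N. 1 + y * q ^ (N - Suc k))"
    by (rule prod.nat_diff_reindex[symmetric])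
  also have "\<dots> = (\<Prod>k<N. (- z / q ^ Suc k) * (1 - q / z * q ^ k))"
  proof (rule prod.cong)
    fix k assume "k \<in> {..<N}"
    then have "q ^ N = q ^ (N - Suc k) * q ^ Suc k"
      by (simp del: power_Suc flip: power_add)
    then show "1 + y * q ^ (N - Suc k) = (- z / q ^ Suc k) * (1 - q / z * q ^ k)"
      using assms by (simp add: y_def field_simps)
  qed simp
  also have "\<dots> = (\<Prod>k<N. - z / q ^ Suc k) * (\<Prod>k<N. 1 - q / z * q ^ k)"
    by (rule prod.distrib)
  also have "(\<Prod>k<N. - z / q ^ Suc k) = C"
    unfolding C_def
  proof (induction N)
    case (Suc N)
    have *: "- (int (Suc (Suc N)) * int (Suc N) div 2) = - (int (Suc N) * int N div 2) + - int (Suc N)"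
      using twice_tri[of "int (Suc N)"] twice_tri[of "int (Suc (Suc N))"] by (simp add: algebra_simps)
    show ?case
      unfolding prod.lessThan_Suc Suc.IH * using assms
      by (subst power_int_add) (auto simp: power_int_minus field_simps simp del: of_nat_Suc)
  qed simp
  finally have A: "(\<Prod>k<N. 1 + y * q ^ k) = C * (\<Prod>k<N. 1 - q / z * q ^ k)" .
  have B: "(\<Prod>k=N..<2*N. 1 + y * q ^ k) = (\<Prod>k<N. 1 - z * q ^ k)"
    by (rule prod.reindex_bij_witness[of _ "\<lambda>k. k + N" "\<lambda>k. k - N"])
       (use assms in \<open>auto simp: y_def power_diff field_simps\<close>)
  have "(\<Prod>k<2*N. 1 + y * q ^ k) = (\<Prod>k<N. 1 + y * q ^ k) * (\<Prod>k=N..<2*N. 1 + y * q ^ k)"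
    using prod.atLeastLessThan_concat[of 0 N "2*N" "\<lambda>k. 1 + y * q ^ k"]
    by (simp add: atLeast0LessThan)
  with A B have "C * ((\<Prod>k<N. 1 - z * q ^ k) * (\<Prod>k<N. 1 - q / z * q ^ k))
      = (\<Sum>k\<le>2*N. q ^ (k choose 2) * qbinom q (2*N) k * y ^ k)"
    by (simp add: qbinom_theorem mult_ac)
  also have "\<dots> = (\<Sum>n\<in>{-int N..int N}. C * ((-1) powi n * q powi (n * (n - 1) div 2) * z powi n
        * qbinom q (2 * N) (nat (n + int N))))"
  \<comment> \<open>Centre the index at \<open>n = k - N\<close>. Completing the exponent, (k choose
    2) - N k = - N (N + 1) / 2 + n (n - 1) / 2, isolates the constant power in
    \<open>C\<close>.\<close>
  proof (rule sum.reindex_bij_witness[of _ "\<lambda>n. nat (n + int N)" "\<lambda>k. int k - int N"])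
    fix k assume k: "k \<in> {..2*N}"
    define n where "n = int k - int N"
    have kn: "int k = n + int N" by (simp add: n_def)
    have "int (k choose 2) - int N * int k = - (int (Suc N) * int N div 2) + n * (n - 1) div 2"
      using twice_tri[of "int k"] twice_tri[of n] twice_tri[of "int (Suc N)"]
      by (simp add: int_choose_two kn algebra_simps)
    then have e: "q ^ (k choose 2) / q ^ (N * k)
        = q powi (- (int (Suc N) * int N div 2)) * q powi (n * (n - 1) div 2)"
      using assms by (simp flip: power_int_add power_int_diff power_int_of_nat)
    have z: "z ^ k = z ^ N * z powi n" "(-1::complex) ^ k = (-1) ^ N * (-1) powi n"
      using assms by (simp_all flip: power_int_of_nat power_int_add add: kn add.commute)
    have y: "y ^ k = (-1) ^ k * z ^ k / q ^ (N * k)"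
      by (simp add: y_def power_divide power_mult power_minus[of "z / q ^ N"])
    have "q ^ (k choose 2) * qbinom q (2*N) k * y ^ k
        = (q ^ (k choose 2) / q ^ (N * k)) * ((-1) ^ k * z ^ k) * qbinom q (2*N) k"
      by (simp add: y)
    also have "\<dots> = C * ((-1) powi n * q powi (n * (n - 1) div 2) * z powi n
        * qbinom q (2 * N) k)"
      unfolding e z C_def by (simp only: mult_ac)
    finally show "C * ((-1) powi (int k - int N) * q powi ((int k - int N) * (int k - int N - 1) div 2)
        * z powi (int k - int N) * qbinom q (2 * N) (nat (int k - int N + int N)))
      = q ^ (k choose 2) * qbinom q (2 * N) k * y ^ k"
      unfolding n_def by (simp only: diff_add_cancel nat_int)
  qed auto
  finally show ?thesis using C0 by (simp flip: sum_distrib_left)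
qed

section \<open>Summability and the limit of the finite triple product\<close>

lemma summable_power_choose_two:
  fixes r w :: real
  assumes "0 < r" "r < 1" "0 < w"
  shows "summable (\<lambda>n. r ^ (n choose 2) * w ^ n)"
proof -
  \<comment> \<open>\<open>r ^ n * w\<close> is the ratio of consecutive terms.\<close>
  have "(\<lambda>n. r ^ n * w) \<longlonglongrightarrow> 0 * w"
    using assms by (intro tendsto_mult LIMSEQ_power_zero tendsto_const) auto
  then have "eventually (\<lambda>n. r ^ n * w < 1/2) sequentially"
    by (intro order_tendstoD(2)[where y = "0 * w"]) auto
  then obtain N where N: "\<And>n. n \<ge> N \<Longrightarrow> r ^ n * w < 1/2"
    by (auto simp: eventually_sequentially)
  show ?thesis
  proof (rule summable_ratio_test[of "1/2" N])
    fix n assume "n \<ge> N"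
    have "r ^ (Suc n choose 2) * w ^ Suc n = (r ^ n * w) * (r ^ (n choose 2) * w ^ n)"
      by (simp add: numeral_2_eq_2 power_add)
    also have "\<dots> \<le> 1/2 * (r ^ (n choose 2) * w ^ n)"
      using N[OF \<open>n \<ge> N\<close>] assms by (intro mult_right_mono) auto
    finally show "norm (r ^ (Suc n choose 2) * w ^ Suc n) \<le> 1/2 * norm (r ^ (n choose 2) * w ^ n)"
      using assms by simp
  qed simp
qed

text \<open>The terms at negative indices form the same one-sided series with \<open>w\<close>
  replaced by \<open>r / w\<close>.\<close>

lemma summable_on_triangular_power:
  fixes r w :: real
  assumes "0 < r" "r < 1" "0 < w"
  shows "(\<lambda>n. r powi (n * (n - 1) div 2) * w powi n) summable_on (UNIV :: int set)"
proof -
  let ?f = "\<lambda>n. r powi (n * (n - 1) div 2) * w powi n"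
  have nat: "(\<lambda>n. r ^ (n choose 2) * v ^ n) summable_on UNIV" if "v > 0" for v
    using summable_power_choose_two[of r v] assms that
    by (intro summable_nonneg_imp_summable_on) auto
  have "?f summable_on range int"
  proof (subst summable_on_reindex)
    show "(?f \<circ> int) summable_on UNIV"
      using nat[of w] assms by (simp add: o_def flip: int_choose_two)
  qed (auto simp: inj_on_def)
  moreover have "?f summable_on range (\<lambda>n. - int n)"
  proof (subst summable_on_reindex)
    have "?f (- int n) = r ^ (n choose 2) * (r / w) ^ n" for n
    proof -
      have *: "- int n * (- int n - 1) div 2 = int (n choose 2) + int n"
        using twice_tri[of "int n"] twice_tri[of "- int n"]
        by (simp add: int_choose_two algebra_simps)
      show ?thesis
        unfolding * using assms
        by (subst power_int_add) (auto simp: power_int_minus power_divide field_simps)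
    qed
    then show "(?f \<circ> (\<lambda>n. - int n)) summable_on UNIV"
      using nat[of "r / w"] assms by (simp add: o_def)
  qed (auto simp: inj_on_def)
  ultimately have "?f summable_on (range int \<union> range (\<lambda>n. - int n))"
    by (rule summable_on_union)
  also have "range int \<union> range (\<lambda>n. - int n) = UNIV"
    by (auto simp: image_iff) (metis int_cases2)
  finally show ?thesis .
qed

lemma qpoch_inf_LIMSEQ:
  assumes "norm q < 1"
  shows "(\<lambda>n. \<Prod>i<n. 1 - a * q ^ i) \<longlonglongrightarrow> qpoch_inf a q"
  using convergent_prod_LIMSEQ[OF convergent_prod_qpoch[OF assms, of a]]
  unfolding qpoch_inf_def LIMSEQ_lessThan_iff_atMost[of "\<lambda>A. prod (\<lambda>i. 1 - a * q ^ i) A" for a] .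

lemma qpoch_inf_nonzero:
  assumes "norm q < 1" "norm a < 1"
  shows "qpoch_inf a q \<noteq> 0"
  unfolding qpoch_inf_def
proof (rule prodinf_nonzero[OF convergent_prod_qpoch[OF assms(1)]])
  fix i
  have "norm (a * q ^ i) < 1"
  proof -
    have "norm a * norm q ^ i \<le> norm a * 1"
      using assms by (intro mult_left_mono power_le_one) auto
    then show ?thesis using assms by (simp add: norm_mult norm_power)
  qed
  then show "1 - a * q ^ i \<noteq> 0" by auto
qed

text \<open>Tannery's theorem: dominated convergence for the counting measure, carried over to
  \<open>infsum\<close>.\<close>

lemma infsum_dominated_convergence:
  fixes f :: "nat \<Rightarrow> 'a \<Rightarrow> complex"
  assumes g: "g summable_on A"
    and lim: "\<And>x. x \<in> A \<Longrightarrow> (\<lambda>n. f n x) \<longlonglongrightarrow> h x"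
    and bound: "\<And>n x. x \<in> A \<Longrightarrow> norm (f n x) \<le> g x"
  shows "(\<lambda>n. infsum (f n) A) \<longlonglongrightarrow> infsum h A"
proof -
  have "(\<lambda>x. norm (g x)) summable_on A"
    using g summable_on_iff_abs_summable_on_real by blast
  then have g': "integrable (count_space A) g"
    using abs_summable_equivalent unfolding abs_summable_on_def by blast
  have h: "integrable (count_space A) h"
    by (rule integrable_dominated_convergence[where s = f and w = g])
       (use g' lim bound in \<open>auto simp: AE_count_space\<close>)
  have f: "integrable (count_space A) (f n)" for n
    by (rule Bochner_Integration.integrable_bound[OF g'])
       (use bound order_trans[OF _ abs_ge_self] in \<open>auto simp: AE_count_space\<close>)
  have "(\<lambda>n. integral\<^sup>L (count_space A) (f n)) \<longlonglongrightarrow> integral\<^sup>L (count_space A) h"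
    by (rule integral_dominated_convergence[where w = g])
       (use g' lim bound in \<open>auto simp: AE_count_space\<close>)
  then show ?thesis
    using infsetsum_infsum[of "f n" A for n] infsetsum_infsum[of h A] f h
    unfolding infsetsum_def abs_summable_on_def by simp
qed

text \<open>Let \<open>N\<close> tend to infinity in the finite form. The Gaussian binomials tend to
  \<open>1 / L\<close> and are uniformly bounded, because the partial products \<open>P\<close> and
  their inverses converge.\<close>

theorem jacobi_triple_product:
  fixes q z :: complex
  assumes q: "norm q < 1" "q \<noteq> 0" and z: "z \<noteq> 0"
  shows "((\<lambda>n. (-1) powi n * q powi (n * (n - 1) div 2) * z powi n) has_sum
    qpoch_inf z q * qpoch_inf (q / z) q * qpoch_inf q q) (UNIV :: int set)"
proof -
  define t where "t n = (-1) powi n * q powi (n * (n - 1) div 2) * z powi n" for n :: int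
  \<comment> \<open>Extension by zero outside the finite range puts all sums over the same index
    set, as dominated convergence requires.\<close>
  define c where "c N n = (if n \<in> {-int N..int N} then qbinom q (2 * N) (nat (n + int N)) else 0)"
    for N n
  define P where "P n = (\<Prod>i<n. 1 - q * q ^ i)" for n
  define L where "L = qpoch_inf q q"
  have P_lim: "P \<longlonglongrightarrow> L"
    unfolding P_def[abs_def] L_def by (rule qpoch_inf_LIMSEQ) fact
  have L0: "L \<noteq> 0"
    unfolding L_def by (rule qpoch_inf_nonzero) fact+
  have P0: "P n \<noteq> 0" for n
  proof -
    have "q * q ^ i \<noteq> 1" for i
    proof
      assume "q * q ^ i = 1"
      then have "norm q ^ Suc i = 1" by (metis norm_one norm_power power_Suc)
      then show False using q power_Suc_less_one[of "norm q" i] by simp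
    qed
    then show ?thesis by (auto simp: P_def)
  qed
  have c_eq: "c N n = P (2 * N) / (P (nat (int N + n)) * P (nat (int N - n)))"
    if "n \<in> {-int N..int N}" for N n
  proof -
    have "2 * N - nat (n + int N) = nat (int N - n)" using that by auto
    then have "c N n * P (nat (n + int N)) * P (nat (int N - n)) = P (2 * N)"
      using qbinom_mult_prod[of "nat (n + int N)" "2 * N" q] that
      by (simp add: c_def P_def nat_le_iff)
    then show ?thesis using P0 by (simp add: field_simps)
  qed
  have "Bseq P" using P_lim convergentI convergent_imp_Bseq by blast
  then obtain K where K: "\<And>n. norm (P n) \<le> K" by (auto simp: Bseq_def)
  have "Bseq (\<lambda>n. inverse (P n))"
    using tendsto_inverse[OF P_lim L0] convergentI convergent_imp_Bseq by blast
  then obtain K' where K': "\<And>n. norm (inverse (P n)) \<le> K'" by (auto simp: Bseq_def)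
  have Kpos: "0 \<le> K" "0 \<le> K'" using K[of 0] K'[of 0] norm_ge_zero order_trans by blast+
  have c_bound: "norm (c N n) \<le> K * (K' * K')" for N n
  proof (cases "n \<in> {-int N..int N}")
    case True
    show ?thesis
      unfolding c_eq[OF True] divide_inverse inverse_mult_distrib norm_mult
      using Kpos by (intro mult_mono K K' mult_nonneg_nonneg) auto
  next
    case False
    then show ?thesis using Kpos by (auto simp: c_def)
  qed
  have c_lim: "(\<lambda>N. c N n) \<longlonglongrightarrow> 1 / L" for n
  proof -
    \<comment> \<open>All three indices in \<open>c_eq\<close> go to infinity with \<open>N\<close>,
      so the limit is \<open>L / (L * L)\<close>.\<close>
    have shift: "filterlim (\<lambda>N. nat (int N + m)) sequentially sequentially" for m
      unfolding filterlim_at_top eventually_sequentially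
    proof
      fix Z
      show "\<exists>N. \<forall>n\<ge>N. Z \<le> nat (int n + m)"
        by (rule exI[of _ "nat (int Z + \<bar>m\<bar>)"]) auto
    qed
    have double: "filterlim (\<lambda>N. 2 * N :: nat) sequentially sequentially"
      by (rule filterlim_subseq) (auto simp: strict_mono_def)
    have "(\<lambda>N. P (2 * N) / (P (nat (int N + n)) * P (nat (int N - n)))) \<longlonglongrightarrow> L / (L * L)"
      using L0 shift[of n] shift[of "- n"] double by (intro tendsto_intros filterlim_compose[OF P_lim]) auto
    moreover have "eventually (\<lambda>N. P (2 * N) / (P (nat (int N + n)) * P (nat (int N - n))) = c N n) sequentially"
      using eventually_ge_at_top[of "nat \<bar>n\<bar>"] by eventually_elim (subst c_eq, auto)
    ultimately show ?thesis using L0 by (auto intro: Lim_transform_eventually)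
  qed
  have norm_t: "norm (t n) = norm q powi (n * (n - 1) div 2) * norm z powi n" for n
    by (simp add: t_def norm_mult norm_power_int)
  have t_abs: "(\<lambda>n. norm (t n)) summable_on UNIV"
    unfolding norm_t using q z by (intro summable_on_triangular_power) auto
  have "(\<lambda>N. infsum (\<lambda>n. t n * c N n) UNIV) \<longlonglongrightarrow> infsum (\<lambda>n. t n * (1 / L)) UNIV"
  proof (rule infsum_dominated_convergence)
    show "(\<lambda>n. norm (t n) * (K * (K' * K'))) summable_on UNIV"
      using t_abs by (rule summable_on_cmult_left)
    show "(\<lambda>N. t n * c N n) \<longlonglongrightarrow> t n * (1 / L)" for n
      by (intro tendsto_intros c_lim)
    show "norm (t n * c N n) \<le> norm (t n) * (K * (K' * K'))" for N n
      unfolding norm_mult by (intro mult_left_mono c_bound) auto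
  qed
  moreover have "infsum (\<lambda>n. t n * c N n) UNIV = (\<Prod>k<N. 1 - z * q ^ k) * (\<Prod>k<N. 1 - q / z * q ^ k)" for N
  proof -
    have "infsum (\<lambda>n. t n * c N n) UNIV = infsum (\<lambda>n. t n * c N n) {-int N..int N}"
      by (rule infsum_cong_neutral) (auto simp: c_def)
    also have "\<dots> = (\<Sum>n\<in>{-int N..int N}. t n * qbinom q (2 * N) (nat (n + int N)))"
      by (simp add: c_def)
    also have "\<dots> = (\<Prod>k<N. 1 - z * q ^ k) * (\<Prod>k<N. 1 - q / z * q ^ k)"
      unfolding t_def by (rule finite_jacobi_triple_product[symmetric]) fact+
    finally show ?thesis .
  qed
  ultimately have "(\<lambda>N. (\<Prod>k<N. 1 - z * q ^ k) * (\<Prod>k<N. 1 - q / z * q ^ k))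
      \<longlonglongrightarrow> infsum (\<lambda>n. t n * (1 / L)) UNIV"
    by simp
  moreover have "(\<lambda>N. (\<Prod>k<N. 1 - z * q ^ k) * (\<Prod>k<N. 1 - q / z * q ^ k))
      \<longlonglongrightarrow> qpoch_inf z q * qpoch_inf (q / z) q"
    by (intro tendsto_intros qpoch_inf_LIMSEQ q)
  ultimately have "infsum (\<lambda>n. t n * (1 / L)) UNIV = qpoch_inf z q * qpoch_inf (q / z) q"
    using LIMSEQ_unique by blast
  then have "infsum t UNIV = qpoch_inf z q * qpoch_inf (q / z) q * L"
    unfolding infsum_cmult_left' using L0 by (simp add: field_simps)
  moreover have "t summable_on UNIV"
    using t_abs abs_summable_summable by blast
  ultimately have "(t has_sum qpoch_inf z q * qpoch_inf (q / z) q * L) UNIV"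
    by (metis has_sum_infsum)
  then show ?thesis by (simp add: t_def[abs_def] L_def)
qed

subsection \<open>The quintuple product\<close>

text \<open>Sort the factors by the residue of the exponent modulo \<open>k\<close>; both sides are
  limits of the partial products of length \<open>n * k\<close>.\<close>

lemma qpoch_inf_split:
  assumes "norm q < 1" "k > 0"
  shows "qpoch_inf a q = (\<Prod>j<k. qpoch_inf (a * q ^ j) (q ^ k))"
proof -
  have qk: "norm (q ^ k) < 1"
    using assms by (simp add: norm_power power_less_one_iff)
  have "(\<lambda>n. \<Prod>j<k. \<Prod>i<n. 1 - a * q ^ j * (q ^ k) ^ i) \<longlonglongrightarrow> (\<Prod>j<k. qpoch_inf (a * q ^ j) (q ^ k))"
    by (intro tendsto_prod qpoch_inf_LIMSEQ qk)
  moreover have "(\<Prod>j<k. \<Prod>i<n. 1 - a * q ^ j * (q ^ k) ^ i) = (\<Prod>i<n * k. 1 - a * q ^ i)" for n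
  proof -
    have "(\<Prod>i<n * k. 1 - a * q ^ i) = (\<Prod>i<n. \<Prod>j<k. 1 - a * q ^ (j + i * k))"
      unfolding prod.nat_group[symmetric]
    proof (rule prod.cong)
      fix m
      show "(\<Prod>i=m*k..<m*k+k. 1 - a * q ^ i) = (\<Prod>j<k. 1 - a * q ^ (j + m * k))"
        by (rule prod.reindex_bij_witness[of _ "\<lambda>j. j + m * k" "\<lambda>i. i - m * k"]) auto
    qed simp
    also have "\<dots> = (\<Prod>j<k. \<Prod>i<n. 1 - a * q ^ (j + i * k))"
      by (rule prod.swap)
    finally show ?thesis
      by (simp add: power_add power_mult mult.assoc mult.commute[of _ k])
  qed
  moreover have "(\<lambda>n. \<Prod>i<n * k. 1 - a * q ^ i) \<longlonglongrightarrow> qpoch_inf a q"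
  proof (rule filterlim_compose[OF qpoch_inf_LIMSEQ[OF assms(1)]])
    show "filterlim (\<lambda>n. n * k) sequentially sequentially"
      using assms(2) by (intro filterlim_subseq) (auto simp: strict_mono_def)
  qed
  ultimately show ?thesis using LIMSEQ_unique by force
qed

section \<open>Sums over the integers and double series\<close>

lemma has_sum_int_blocks:
  fixes f :: "int \<Rightarrow> complex"
  assumes "(f has_sum S) UNIV" "k > 0"
  shows "((\<lambda>s. \<Sum>i\<in>{a..<a+k}. f (k * s + i)) has_sum S) UNIV"
proof -
  \<comment> \<open>Division of \<open>n - a\<close> by \<open>k\<close> writes \<open>n\<close>
    uniquely as \<open>k * s + i\<close> with \<open>i\<close> in the window.\<close>
  have "((\<lambda>(s, i). f (k * s + i)) has_sum S) (UNIV \<times> {a..<a+k})"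
    by (rule iffD1[OF has_sum_reindex_bij_witness
          [where i = "\<lambda>(s, i). k * s + i" and j = "\<lambda>n. ((n - a) div k, (n - a) mod k + a)"] assms(1)])
       (use assms(2) in \<open>auto simp flip: add_diff_eq simp: div_pos_pos_trivial\<close>)
  then show ?thesis
    by (rule has_sum_SigmaD) (auto intro: has_sum_finiteI)
qed

lemma has_sum_shift_int: "((\<lambda>n. f (n + a)) has_sum S) UNIV \<longleftrightarrow> (f has_sum S) UNIV" for a :: int
  by (rule has_sum_reindex_bij_witness[of _ "\<lambda>n. n - a" "\<lambda>n. n + a"]) auto

lemma has_sum_reflect_int: "((\<lambda>n. f (a - n)) has_sum S) UNIV \<longleftrightarrow> (f has_sum S) UNIV" for a :: int
  by (rule has_sum_reindex_bij_witness[of _ "\<lambda>n. a - n" "\<lambda>n. a - n"]) auto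

text \<open>Complex summability is absolute, so the product family is summable over the product set
  and may be summed one variable at a time.\<close>

lemma has_sum_Times_mult:
  fixes f :: "'a \<Rightarrow> complex" and g :: "'b \<Rightarrow> complex"
  assumes "(f has_sum S) A" "(g has_sum T) B"
  shows "((\<lambda>(x, y). f x * g y) has_sum S * T) (A \<times> B)"
proof (rule has_sum_SigmaI)
  have f: "(\<lambda>x. norm (f x)) summable_on A" and g: "(\<lambda>x. norm (g x)) summable_on B"
    using assms has_sum_imp_summable summable_on_iff_abs_summable_on_complex by blast+
  have "(\<lambda>(x, y). norm (f x) * norm (g y)) summable_on A \<times> B"
    by (rule summable_on_SigmaI[where g = "\<lambda>x. norm (f x) * infsum (\<lambda>y. norm (g y)) B"])
       (use f g in \<open>auto intro!: has_sum_cmult_right summable_on_cmult_left\<close>)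
  then have "(\<lambda>p. norm (case p of (x, y) \<Rightarrow> f x * g y)) summable_on A \<times> B"
    by (simp add: case_prod_unfold norm_mult)
  then show "(\<lambda>(x, y). f x * g y) summable_on A \<times> B"
    by (rule abs_summable_summable)
qed (use assms in \<open>auto intro: has_sum_cmult_right has_sum_cmult_left\<close>)

text \<open>Writing a n^2 + b n = 2 a (n (n - 1) / 2) + (a + b) n reduces the norms to the
  triangular case.\<close>

lemma summable_on_quadratic_power:
  fixes q :: complex and a b c :: int
  assumes q: "norm q < 1" "q \<noteq> 0" and "a > 0"
  shows "(\<lambda>n. q powi (a * n\<^sup>2 + b * n + c)) summable_on UNIV"
proof -
  let ?r = "norm q powi (2 * a)" and ?w = "norm q powi (a + b)"
  have "?r < 1"
    using assms power_int_strict_decreasing[of 0 "2 * a" "norm q"] by simp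
  then have "(\<lambda>n. ?r powi (n * (n - 1) div 2) * ?w powi n) summable_on UNIV"
    using q by (intro summable_on_triangular_power) auto
  then have "(\<lambda>n. norm q powi c * (?r powi (n * (n - 1) div 2) * ?w powi n)) summable_on UNIV"
    by (rule summable_on_cmult_right)
  also have "(\<lambda>n. norm q powi c * (?r powi (n * (n - 1) div 2) * ?w powi n))
      = (\<lambda>n. norm (q powi (a * n\<^sup>2 + b * n + c)))"
  proof
    fix n
    have "c + (2 * a * (n * (n - 1) div 2) + (a + b) * n) = a * n\<^sup>2 + b * n + c"
      unfolding mult.assoc mult.left_commute[of 2 a] twice_tri by (simp add: algebra_simps power2_eq_square)
    then show "norm q powi c * (?r powi (n * (n - 1) div 2) * ?w powi n)
        = norm (q powi (a * n\<^sup>2 + b * n + c))"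
      using q by (simp only: norm_power_int power_int_mult[symmetric] power_int_add[symmetric] norm_eq_zero
          de_Morgan_conj not_False_eq_True simp_thms)
  qed
  finally show ?thesis
    by (rule abs_summable_summable)
qed

text \<open>The triple product in base \<open>q ^ 3\<close> at \<open>z = q ^ 2\<close>; its three
  products are the residue classes modulo 3 of the factors of \<open>qpoch_inf q q\<close>.\<close>

lemma euler_pentagonal:
  fixes q :: complex
  assumes q: "norm q < 1" "q \<noteq> 0"
  shows "((\<lambda>n. (-1) powi n * q powi (n * (3 * n + 1) div 2)) has_sum qpoch_inf q q) (UNIV :: int set)"
proof -
  have q3: "norm (q ^ 3) < 1"
    using q by (simp add: norm_power power_less_one_iff)
  have "(\<lambda>n. (-1) powi n * (q ^ 3) powi (n * (n - 1) div 2) * (q\<^sup>2) powi n)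
      = (\<lambda>n. (-1) powi n * q powi (n * (3 * n + 1) div 2))"
  proof
    fix n :: int
    have "3 * t + 2 * n = p" if "2 * t = n * (n - 1)" "2 * p = n * (3 * n + 1)" for t p
      using that by (simp add: algebra_simps)
    from this[OF twice_tri twice_pent] have "(q ^ 3) powi (n * (n - 1) div 2) * (q\<^sup>2) powi n = q powi (n * (3 * n + 1) div 2)"
      using q by (simp flip: power_int_mult power_int_add power_int_numeral)
    then show "(-1) powi n * (q ^ 3) powi (n * (n - 1) div 2) * (q\<^sup>2) powi n
        = (-1) powi n * q powi (n * (3 * n + 1) div 2)"
      by simp
  qed
  moreover have "qpoch_inf q q = qpoch_inf (q\<^sup>2) (q ^ 3) * qpoch_inf (q ^ 3 / q\<^sup>2) (q ^ 3) * qpoch_inf (q ^ 3) (q ^ 3)"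
    using q by (subst qpoch_inf_split[OF q(1), of 3])
      (auto simp: numeral_3_eq_3 power2_eq_square power3_eq_cube mult_ac)
  ultimately show ?thesis
    using jacobi_triple_product[OF q3, of "q\<^sup>2"] q by simp
qed

text \<open>
  Up to \<open>(q\<^sup>2; q\<^sup>2)\<^sub>\<infinity>\<close>, the product is that of two Jacobi triple products, hence a double series whose
  coefficient of \<open>z\<^sup>r\<close> is again a theta series; by the pentagonal number theorem in base \<open>q\<^sup>2\<close> it is
  zero or a monomial times \<open>(q\<^sup>2; q\<^sup>2)\<^sub>\<infinity>\<close>, depending on \<open>r\<close> modulo 3.
\<close>

theorem quintuple_product:
  fixes q z :: complex
  assumes q: "norm q < 1" "q \<noteq> 0" and z: "z \<noteq> 0"
  shows "((\<lambda>s. q powi (s * (3 * s - 1) div 2) * z powi (3 * s)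
            - q powi (s * (3 * s + 1) div 2) * z powi (3 * s + 1)) has_sum
    qpoch_inf z q * qpoch_inf (q / z) q * qpoch_inf q q *
    (qpoch_inf (q * z\<^sup>2) (q\<^sup>2) * qpoch_inf (q / z\<^sup>2) (q\<^sup>2))) (UNIV :: int set)"
proof -
  define U where "U = qpoch_inf z q * qpoch_inf (q / z) q * qpoch_inf q q"
  define V where "V = qpoch_inf (q * z\<^sup>2) (q\<^sup>2) * qpoch_inf (q / z\<^sup>2) (q\<^sup>2)"
  define D where "D = qpoch_inf (q\<^sup>2) (q\<^sup>2)"
  \<comment> \<open>\<open>u\<close> and \<open>v\<close> are the terms of the triple products in
    base \<open>q\<close> at \<open>z\<close> and in base \<open>q ^ 2\<close> at
    \<open>q * z ^ 2\<close>.\<close>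
  define u where "u n = (-1) powi n * q powi (n * (n - 1) div 2) * z powi n" for n
  define v where "v n = (-1) powi n * (q\<^sup>2) powi (n * (n - 1) div 2) * (q * z\<^sup>2) powi n" for n
  \<comment> \<open>With \<open>n = r - 2 * m\<close>, the term \<open>u n * v m\<close> has
    \<open>z\<close>-exponent \<open>r\<close> and splits into \<open>h r\<close>, free of
    \<open>m\<close>, and the theta term \<open>w r m\<close>.\<close>
  define h where "h r = (-1) powi r * q powi (r * (r - 1) div 2) * z powi r" for r
  define w where "w r m = (-1) powi m * q powi (3 * m\<^sup>2 - (2 * r - 1) * m)" for r m
  have q2: "norm (q\<^sup>2) < 1" "q\<^sup>2 \<noteq> 0"
    using q by (auto simp: norm_power power_less_one_iff)
  have D0: "D \<noteq> 0"
    unfolding D_def by (rule qpoch_inf_nonzero) fact+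
  have uv: "((\<lambda>(n, m). u n * v m) has_sum U * (V * D)) (UNIV \<times> UNIV)"
  proof (rule has_sum_Times_mult)
    show "(u has_sum U) UNIV"
      unfolding u_def[abs_def] U_def by (rule jacobi_triple_product) fact+
    have "q\<^sup>2 / (q * z\<^sup>2) = q / z\<^sup>2"
      using q by (simp add: power2_eq_square)
    then show "(v has_sum V * D) UNIV"
      using jacobi_triple_product[OF q2, of "q * z\<^sup>2"] q z
      unfolding v_def[abs_def] V_def D_def by simp
  qed
  have uv_eq: "u (r - 2 * m) * v m = h r * w r m" for r m
  proof -
    have s: "(-1::complex) powi (r - 2 * m) = (-1) powi r"
      by (simp add: power_int_minus_left)
    have "t + (2 * t1 + m) = t0 + (3 * m\<^sup>2 - (2 * r - 1) * m)"
      if "2 * t = (r - 2 * m) * (r - 2 * m - 1)" "2 * t0 = r * (r - 1)" "2 * t1 = m * (m - 1)" for t t0 t1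
      using that by (simp add: algebra_simps power2_eq_square)
    note e = this[OF twice_tri twice_tri twice_tri]
    have "u (r - 2 * m) * v m = ((-1) powi (r - 2 * m) * (-1) powi m) *
        (q powi ((r - 2 * m) * (r - 2 * m - 1) div 2) * (q powi (2 * (m * (m - 1) div 2)) * q powi m))
        * (z powi (r - 2 * m) * z powi (2 * m))"
      unfolding u_def v_def power_int_mult_distrib power_int_mult by (simp add: mult_ac)
    also have "\<dots> = ((-1) powi r * (-1) powi m) *
        (q powi (r * (r - 1) div 2) * q powi (3 * m\<^sup>2 - (2 * r - 1) * m)) * z powi r"
      using q z by (simp only: s e power_int_add[symmetric] simp_thms) simp
    also have "\<dots> = h r * w r m"
      by (simp add: h_def w_def mult_ac)
    finally show ?thesis .
  qed
  have hw: "((\<lambda>(r, m). h r * w r m) has_sum U * (V * D)) (UNIV \<times> UNIV)"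
    by (rule iffD1[OF has_sum_reindex_bij_witness
          [where i = "\<lambda>(r, m). (r - 2 * m, m)" and j = "\<lambda>(n, m). (n + 2 * m, m)"] uv])
       (auto simp flip: uv_eq)
  define W where "W r = infsum (w r) UNIV" for r
  have w: "(w r has_sum W r) UNIV" for r
  proof -
    have "(\<lambda>m. norm (w r m)) = (\<lambda>m. norm (q powi (3 * m\<^sup>2 + (1 - 2 * r) * m + 0)))"
      by (auto simp: w_def norm_mult norm_power_int algebra_simps)
    moreover have "(\<lambda>m. norm (q powi (3 * m\<^sup>2 + (1 - 2 * r) * m + 0))) summable_on UNIV"
      unfolding summable_on_iff_abs_summable_on_complex[symmetric]
      by (intro summable_on_quadratic_power q) simp
    ultimately have "w r summable_on UNIV"
      by (simp only: summable_on_iff_abs_summable_on_complex)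
    then show ?thesis by (simp add: W_def)
  qed
  from hw have g: "((\<lambda>r. h r * W r) has_sum U * (V * D)) UNIV"
    by (rule has_sum_SigmaD) (auto intro: has_sum_cmult_right w)
  have pent: "((\<lambda>m. (-1) powi m * q powi (3 * m\<^sup>2 + m)) has_sum D) UNIV"
  proof -
    have "(q\<^sup>2) powi (m * (3 * m + 1) div 2) = q powi (3 * m\<^sup>2 + m)" for m :: int
    proof -
      have "(q\<^sup>2) powi (m * (3 * m + 1) div 2) = q powi (2 * (m * (3 * m + 1) div 2))"
        by (simp only: power_int_power of_nat_numeral)
      then show ?thesis
        unfolding twice_pent by (simp add: algebra_simps power2_eq_square)
    qed
    then show ?thesis using euler_pentagonal[OF q2] by (simp add: D_def)
  qed
  \<comment> \<open>For \<open>r = 3 * s\<close> the shift of \<open>m\<close> by \<open>s\<close>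
    turns the exponent into the pentagonal one plus a constant.\<close>
  have W0: "W (3 * s) = (-1) powi s * q powi (s - 3 * s\<^sup>2) * D" for s
  proof -
    have "w (3 * s) (m + s) = (-1) powi s * q powi (s - 3 * s\<^sup>2) * ((-1) powi m * q powi (3 * m\<^sup>2 + m))" for m
    proof -
      have "3 * (m + s)\<^sup>2 - (2 * (3 * s) - 1) * (m + s) = (s - 3 * s\<^sup>2) + (3 * m\<^sup>2 + m)"
        by (simp add: algebra_simps power2_eq_square)
      then show ?thesis
        unfolding w_def using q by (simp add: power_int_add)
    qed
    then have "((\<lambda>m. w (3 * s) (m + s)) has_sum (-1) powi s * q powi (s - 3 * s\<^sup>2) * D) UNIV"
      by (simp only:) (rule has_sum_cmult_right[OF pent])
    then have "(w (3 * s) has_sum (-1) powi s * q powi (s - 3 * s\<^sup>2) * D) UNIV"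
      by (simp only: has_sum_shift_int)
    then show ?thesis using w has_sum_unique by blast
  qed
  \<comment> \<open>Here the reflection \<open>s - m\<close> plays the role of the shift.\<close>
  have W1: "W (3 * s + 1) = (-1) powi s * q powi (- s - 3 * s\<^sup>2) * D" for s
  proof -
    have "w (3 * s + 1) (s - m) = (-1) powi s * q powi (- s - 3 * s\<^sup>2) * ((-1) powi m * q powi (3 * m\<^sup>2 + m))" for m
    proof -
      have "3 * (s - m)\<^sup>2 - (2 * (3 * s + 1) - 1) * (s - m) = (- s - 3 * s\<^sup>2) + (3 * m\<^sup>2 + m)"
        by (simp add: algebra_simps power2_eq_square)
      moreover have "(-1::complex) powi (s - m) = (-1) powi s * (-1) powi m"
        by (simp add: power_int_minus_left)
      ultimately show ?thesis
        unfolding w_def using q by (simp add: power_int_add)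
    qed
    then have "((\<lambda>m. w (3 * s + 1) (s - m)) has_sum (-1) powi s * q powi (- s - 3 * s\<^sup>2) * D) UNIV"
      by (simp only:) (rule has_sum_cmult_right[OF pent])
    then have "(w (3 * s + 1) has_sum (-1) powi s * q powi (- s - 3 * s\<^sup>2) * D) UNIV"
      by (simp only: has_sum_reflect_int)
    then show ?thesis using w has_sum_unique by blast
  qed
  \<comment> \<open>The reflection of \<open>m\<close> to \<open>2 * s + 1 - m\<close> keeps the
    exponent and flips the sign, so the sum equals its own negative.\<close>
  have W2: "W (3 * s + 2) = 0" for s
  proof -
    have "w (3 * s + 2) (2 * s + 1 - m) = - w (3 * s + 2) m" for m
    proof -
      have "3 * (2 * s + 1 - m)\<^sup>2 - (2 * (3 * s + 2) - 1) * (2 * s + 1 - m) = 3 * m\<^sup>2 - (2 * (3 * s + 2) - 1) * m"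
        by (simp add: algebra_simps power2_eq_square)
      moreover have "(-1::complex) powi (2 * s + 1 - m) = - ((-1) powi m)"
        by (simp add: power_int_minus_left)
      ultimately show ?thesis
        unfolding w_def by simp
    qed
    moreover have "((\<lambda>m. w (3 * s + 2) (2 * s + 1 - m)) has_sum W (3 * s + 2)) UNIV"
      unfolding has_sum_reflect_int by (rule w)
    ultimately have "((\<lambda>m. - w (3 * s + 2) m) has_sum W (3 * s + 2)) UNIV"
      by simp
    then have "W (3 * s + 2) = - W (3 * s + 2)"
      using has_sum_uminusI[OF w] has_sum_unique by blast
    then show ?thesis by simp
  qed
  let ?t = "\<lambda>s. q powi (s * (3 * s - 1) div 2) * z powi (3 * s)
            - q powi (s * (3 * s + 1) div 2) * z powi (3 * s + 1)"
  have "(\<Sum>i\<in>{0..<0+3}. h (3 * s + i) * W (3 * s + i)) = ?t s * D" for s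
  proof -
    have "t + (s - 3 * s\<^sup>2) = p" if "2 * t = (3 * s) * (3 * s - 1)" "2 * p = s * (3 * s - 1)" for t p
      using that by (simp add: algebra_simps power2_eq_square)
    note e0 = this[OF twice_tri twice_pent']
    have "t + (- s - 3 * s\<^sup>2) = p"
      if "2 * t = (3 * s + 1) * (3 * s + 1 - 1)" "2 * p = s * (3 * s + 1)" for t p
      using that by (simp add: algebra_simps power2_eq_square)
    note e1 = this[OF twice_tri twice_pent]
    have "h (3 * s) * W (3 * s) = q powi (s * (3 * s - 1) div 2) * z powi (3 * s) * D"
      unfolding h_def W0 e0[symmetric] using q by (simp add: power_int_add power_int_minus_left)
    moreover have "h (3 * s + 1) * W (3 * s + 1) = - (q powi (s * (3 * s + 1) div 2) * z powi (3 * s + 1) * D)"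
      unfolding h_def W1 e1[symmetric] using q by (simp add: power_int_add power_int_minus_left)
    moreover have "{0..<0+3} = {0, 1, 2::int}" by auto
    ultimately show ?thesis
      using W2[of s] by (simp add: left_diff_distrib)
  qed
  then have "((\<lambda>s. ?t s * D) has_sum (U * V) * D) UNIV"
    using has_sum_int_blocks[OF g, of 3 0] by (simp add: mult.assoc)
  then show ?thesis
    using D0 unfolding U_def V_def by (simp add: has_sum_cmult_left_iff)
qed

subsection \<open>Dissections by parity\<close>

lemma has_sum_diff:
  fixes f g :: "'a \<Rightarrow> complex"
  assumes "(f has_sum S) A" "(g has_sum T) A"
  shows "((\<lambda>x. f x - g x) has_sum S - T) A"
  using has_sum_add[OF assms(1) has_sum_uminusI[OF assms(2)]] by simp

text \<open>Unsigned theta series: after dissection all signs and odd powers of \<open>x\<close>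
  become coefficients outside, and series are matched by reflecting or shifting
  \<open>n\<close>.\<close>

definition quad_theta :: "complex \<Rightarrow> int \<Rightarrow> int \<Rightarrow> int \<Rightarrow> complex" where
  "quad_theta q a b c = (\<Sum>\<^sub>\<infinity>n::int. q powi (a * n\<^sup>2 + b * n + c))"

lemma has_sum_quad_theta:
  assumes "norm q < 1" "q \<noteq> 0" "a > 0"
  shows "((\<lambda>n. q powi (a * n\<^sup>2 + b * n + c)) has_sum quad_theta q a b c) UNIV"
  unfolding quad_theta_def using summable_on_quadratic_power[OF assms] by (rule has_sum_infsum)

lemma quad_theta_reflect: "quad_theta q a (- b) c = quad_theta q a b c"
  unfolding quad_theta_def
  by (rule infsum_reindex_bij_witness[of _ uminus uminus]) auto

lemma quad_theta_shift: "quad_theta q a (b + 2 * a * k) (a * k\<^sup>2 + b * k + c) = quad_theta q a b c"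
  unfolding quad_theta_def
  by (rule infsum_reindex_bij_witness[of _ "\<lambda>n. n - k" "\<lambda>n. n + k"])
     (auto simp: algebra_simps power2_eq_square)

lemma power_int_even_odd:
  fixes x :: complex
  assumes "x \<noteq> 0"
  shows "x powi (2 * e) = (x\<^sup>2) powi e" "x powi (2 * e + 1) = x * (x\<^sup>2) powi e"
  using assms by (simp_all add: power_int_mult power_int_add)

text \<open>Blocks of four suit the dissections because the parities of n (3 n + 1) / 2, (15 n^2 + 7
  n) / 2 and (15 n^2 + 17 n + 4) / 2 have period 4 in n.\<close>

lemma has_sum_int_blocks4:
  fixes f :: "int \<Rightarrow> complex"
  assumes "(f has_sum S) UNIV"
  shows "((\<lambda>m. f (4 * m - 2) + f (4 * m - 1) + f (4 * m) + f (4 * m + 1)) has_sum S) UNIV"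
proof -
  have "{-2..<-2+4} = {-2, -1, 0, 1::int}" by auto
  then show ?thesis
    using has_sum_int_blocks[OF assms, of 4 "-2"] by (simp add: add_ac)
qed

text \<open>In the pentagonal series for base \<open>x\<close>, the indices \<open>4 * m - 2\<close>
  and \<open>4 * m - 1\<close> have odd exponents, \<open>4 * m\<close> and \<open>4 * m + 1\<close>
  even ones.\<close>

lemma qpoch_inf_self_dissection:
  assumes x: "norm x < 1" "x \<noteq> 0" and q: "q = x\<^sup>2"
  shows "qpoch_inf x x = (quad_theta q 12 1 0 - quad_theta q 12 7 1)
    - x * (quad_theta q 12 5 0 - quad_theta q 12 13 3)"
proof -
  have qn: "norm q < 1" "q \<noteq> 0"
    using x by (auto simp: q norm_power power_less_one_iff)
  let ?f = "\<lambda>n. (-1) powi n * x powi (n * (3 * n + 1) div 2)"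
  have block: "?f (4 * m - 2) + ?f (4 * m - 1) + ?f (4 * m) + ?f (4 * m + 1)
    = x * q powi (12 * m\<^sup>2 + (-11) * m + 2) - x * q powi (12 * m\<^sup>2 + (-5) * m + 0)
      + q powi (12 * m\<^sup>2 + 1 * m + 0) - q powi (12 * m\<^sup>2 + 7 * m + 1)" for m :: int
  proof -
    have e: "(4 * m - 2) * (3 * (4 * m - 2) + 1) div 2 = 2 * (12 * m\<^sup>2 + (-11) * m + 2) + 1"
      "(4 * m - 1) * (3 * (4 * m - 1) + 1) div 2 = 2 * (12 * m\<^sup>2 + (-5) * m + 0) + 1"
      "(4 * m) * (3 * (4 * m) + 1) div 2 = 2 * (12 * m\<^sup>2 + 1 * m + 0)"
      "(4 * m + 1) * (3 * (4 * m + 1) + 1) div 2 = 2 * (12 * m\<^sup>2 + 7 * m + 1)"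
      by (rule pent_eqI, simp add: algebra_simps power2_eq_square)+
    show ?thesis
      unfolding e power_int_even_odd[OF x(2)] q[symmetric] by (simp add: power_int_minus_left)
  qed
  have "((\<lambda>m. x * q powi (12 * m\<^sup>2 + (-11) * m + 2) - x * q powi (12 * m\<^sup>2 + (-5) * m + 0)
      + q powi (12 * m\<^sup>2 + 1 * m + 0) - q powi (12 * m\<^sup>2 + 7 * m + 1)) has_sum
      x * quad_theta q 12 (-11) 2 - x * quad_theta q 12 (-5) 0
      + quad_theta q 12 1 0 - quad_theta q 12 7 1) UNIV"
    by (intro has_sum_add has_sum_diff has_sum_cmult_right has_sum_quad_theta qn) simp_all
  moreover have "((\<lambda>m. x * q powi (12 * m\<^sup>2 + (-11) * m + 2) - x * q powi (12 * m\<^sup>2 + (-5) * m + 0)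
      + q powi (12 * m\<^sup>2 + 1 * m + 0) - q powi (12 * m\<^sup>2 + 7 * m + 1)) has_sum qpoch_inf x x) UNIV"
    unfolding block[symmetric] by (rule has_sum_int_blocks4[OF euler_pentagonal[OF x]])
  ultimately have "qpoch_inf x x = x * quad_theta q 12 (-11) 2 - x * quad_theta q 12 (-5) 0
      + quad_theta q 12 1 0 - quad_theta q 12 7 1"
    using has_sum_unique by blast
  also have "quad_theta q 12 (-11) 2 = quad_theta q 12 13 3"
    using quad_theta_shift[of q 12 13 "-1" 3] by simp
  also have "quad_theta q 12 (-5) 0 = quad_theta q 12 5 0"
    by (rule quad_theta_reflect)
  finally show ?thesis by (simp add: algebra_simps)
qed

text \<open>The quintuple product in base \<open>q ^ 8\<close> at \<open>z = q ^ 3\<close>.\<close>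

lemma quintuple_product_8_3:
  assumes q: "norm q < 1" "q \<noteq> 0"
  shows "quad_theta q 12 5 0 - quad_theta q 12 13 3
    = qpochs_inf [q ^ 3, q ^ 5, q ^ 8] (q ^ 8) * qpochs_inf [q ^ 2, q ^ 14] (q ^ 16)"
proof -
  have q8: "norm (q ^ 8) < 1" "q ^ 8 \<noteq> 0" "q ^ 3 \<noteq> 0"
    using q by (auto simp: norm_power power_less_one_iff)
  have block: "(q ^ 8) powi (s * (3 * s - 1) div 2) * (q ^ 3) powi (3 * s)
      - (q ^ 8) powi (s * (3 * s + 1) div 2) * (q ^ 3) powi (3 * s + 1)
    = q powi (12 * s\<^sup>2 + 5 * s + 0) - q powi (12 * s\<^sup>2 + 13 * s + 3)" for s :: int
  proof -
    have e: "12 * s\<^sup>2 + 5 * s + 0 = 8 * p' + 3 * (3 * s)" "12 * s\<^sup>2 + 13 * s + 3 = 8 * p + 3 * (3 * s + 1)"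
      if "2 * p' = s * (3 * s - 1)" "2 * p = s * (3 * s + 1)" for p p'
      using that by (simp_all add: algebra_simps power2_eq_square)
    show ?thesis
      unfolding e[OF twice_pent' twice_pent]
      by (simp only: power_int_power power_int_add[OF disjI1[OF q(2)]] of_nat_numeral)
  qed
  have "((\<lambda>s. q powi (12 * s\<^sup>2 + 5 * s + 0) - q powi (12 * s\<^sup>2 + 13 * s + 3)) has_sum
      quad_theta q 12 5 0 - quad_theta q 12 13 3) UNIV"
    by (intro has_sum_diff has_sum_quad_theta q) simp_all
  moreover note quintuple_product[OF q8, unfolded block]
  ultimately have "quad_theta q 12 5 0 - quad_theta q 12 13 3
    = qpoch_inf (q ^ 3) (q ^ 8) * qpoch_inf (q ^ 8 / q ^ 3) (q ^ 8) * qpoch_inf (q ^ 8) (q ^ 8) *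
      (qpoch_inf (q ^ 8 * (q ^ 3)\<^sup>2) ((q ^ 8)\<^sup>2) * qpoch_inf (q ^ 8 / (q ^ 3)\<^sup>2) ((q ^ 8)\<^sup>2))"
    using has_sum_unique by blast
  moreover have "q ^ 8 / q ^ 3 = q ^ 5" "q ^ 8 / (q ^ 3)\<^sup>2 = q\<^sup>2" "q ^ 8 * (q ^ 3)\<^sup>2 = q ^ 14" "(q ^ 8)\<^sup>2 = q ^ 16"
    using q by (simp_all flip: power_mult power_add power_diff)
  ultimately show ?thesis by (simp add: qpochs_inf_def mult_ac)
qed

text \<open>The quintuple product in base \<open>x ^ 5\<close> at \<open>z = x ^ 2\<close>, split by
  parity of the exponent and multiplied by the factors of \<open>qpoch_inf x x\<close> that it
  lacks.\<close>

lemma quintuple_product_5_2_dissection: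
  assumes x: "norm x < 1" "x \<noteq> 0" and q: "q = x\<^sup>2"
  shows "qpoch_inf x x = ((quad_theta q 60 7 0 + quad_theta q 60 23 2 - quad_theta q 60 17 1 - quad_theta q 60 47 9)
    - x * (quad_theta q 60 13 0 - quad_theta q 60 37 5 + quad_theta q 60 43 7 - quad_theta q 60 53 11))
    * qpochs_inf [q ^ 2, q ^ 3] (q ^ 5)"
proof -
  have qn: "norm q < 1" "q \<noteq> 0"
    using x by (auto simp: q norm_power power_less_one_iff)
  have x5: "norm (x ^ 5) < 1" "x ^ 5 \<noteq> 0" "x ^ 2 \<noteq> 0"
    using x by (auto simp: norm_power power_less_one_iff)
  define Q where "Q = qpoch_inf (x\<^sup>2) (x ^ 5) * qpoch_inf (x ^ 3) (x ^ 5) * qpoch_inf (x ^ 5) (x ^ 5) *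
      (qpoch_inf (x ^ 9) (x ^ 10) * qpoch_inf x (x ^ 10))"
  have "x ^ 5 / x\<^sup>2 = x ^ 3" "x ^ 5 / (x\<^sup>2)\<^sup>2 = x" "x ^ 5 * (x\<^sup>2)\<^sup>2 = x ^ 9" "(x ^ 5)\<^sup>2 = x ^ 10"
    using x by (simp_all flip: power_mult power_add power_diff)
  note quint = quintuple_product[OF x5, unfolded this, folded Q_def]
  let ?f = "\<lambda>s. (x ^ 5) powi (s * (3 * s - 1) div 2) * (x\<^sup>2) powi (3 * s)
      - (x ^ 5) powi (s * (3 * s + 1) div 2) * (x\<^sup>2) powi (3 * s + 1)"
  have f: "?f s = x powi e - x powi e'"
    if "2 * e = 15 * s\<^sup>2 + 7 * s" "2 * e' = 15 * s\<^sup>2 + 17 * s + 4" for s e e' :: int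
  proof -
    have e: "e = 5 * p' + 2 * (3 * s)" "e' = 5 * p + 2 * (3 * s + 1)"
      if "2 * p' = s * (3 * s - 1)" "2 * p = s * (3 * s + 1)" for p p'
      using that \<open>2 * e = _\<close> \<open>2 * e' = _\<close> by (simp_all add: algebra_simps power2_eq_square)
    show ?thesis
      unfolding e[OF twice_pent' twice_pent]
      by (simp only: power_int_power power_int_add[OF disjI1[OF x(2)]] of_nat_numeral)
  qed
  \<comment> \<open>The terms with odd exponent have linear coefficients 13, 37, 43, 53 up to sign,
    which are square roots of 169 modulo 240.\<close>
  have block: "?f (4 * m - 2) + ?f (4 * m - 1) + ?f (4 * m) + ?f (4 * m + 1)
    = (x * q powi (60 * m\<^sup>2 + (-53) * m + 11) - x * q powi (60 * m\<^sup>2 + (-43) * m + 7))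
      + (q powi (60 * m\<^sup>2 + (-23) * m + 2) - x * q powi (60 * m\<^sup>2 + (-13) * m + 0))
      + (q powi (60 * m\<^sup>2 + 7 * m + 0) - q powi (60 * m\<^sup>2 + 17 * m + 1))
      + (x * q powi (60 * m\<^sup>2 + 37 * m + 5) - q powi (60 * m\<^sup>2 + 47 * m + 9))" for m :: int
  proof -
    have "?f (4 * m - 2) = x powi (2 * (60 * m\<^sup>2 + (-53) * m + 11) + 1) - x powi (2 * (60 * m\<^sup>2 + (-43) * m + 7) + 1)"
      by (rule f) (simp_all add: algebra_simps power2_eq_square)
    moreover have "?f (4 * m - 1) = x powi (2 * (60 * m\<^sup>2 + (-23) * m + 2)) - x powi (2 * (60 * m\<^sup>2 + (-13) * m + 0) + 1)"
      by (rule f) (simp_all add: algebra_simps power2_eq_square)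
    moreover have "?f (4 * m) = x powi (2 * (60 * m\<^sup>2 + 7 * m + 0)) - x powi (2 * (60 * m\<^sup>2 + 17 * m + 1))"
      by (rule f) (simp_all add: algebra_simps power2_eq_square)
    moreover have "?f (4 * m + 1) = x powi (2 * (60 * m\<^sup>2 + 37 * m + 5) + 1) - x powi (2 * (60 * m\<^sup>2 + 47 * m + 9))"
      by (rule f) (simp_all add: algebra_simps power2_eq_square)
    ultimately show ?thesis
      unfolding power_int_even_odd[OF x(2)] q[symmetric] by (simp only:)
  qed
  have "((\<lambda>m. (x * q powi (60 * m\<^sup>2 + (-53) * m + 11) - x * q powi (60 * m\<^sup>2 + (-43) * m + 7))
      + (q powi (60 * m\<^sup>2 + (-23) * m + 2) - x * q powi (60 * m\<^sup>2 + (-13) * m + 0))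
      + (q powi (60 * m\<^sup>2 + 7 * m + 0) - q powi (60 * m\<^sup>2 + 17 * m + 1))
      + (x * q powi (60 * m\<^sup>2 + 37 * m + 5) - q powi (60 * m\<^sup>2 + 47 * m + 9))) has_sum
      (x * quad_theta q 60 (-53) 11 - x * quad_theta q 60 (-43) 7)
      + (quad_theta q 60 (-23) 2 - x * quad_theta q 60 (-13) 0)
      + (quad_theta q 60 7 0 - quad_theta q 60 17 1)
      + (x * quad_theta q 60 37 5 - quad_theta q 60 47 9)) UNIV"
    by (intro has_sum_add has_sum_diff has_sum_cmult_right has_sum_quad_theta qn) simp_all
  from has_sum_unique[OF has_sum_int_blocks4[OF quint, unfolded block] this]
  have "Q = (quad_theta q 60 7 0 + quad_theta q 60 23 2 - quad_theta q 60 17 1 - quad_theta q 60 47 9)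
    - x * (quad_theta q 60 13 0 - quad_theta q 60 37 5 + quad_theta q 60 43 7 - quad_theta q 60 53 11)"
    unfolding quad_theta_reflect by (simp add: algebra_simps)
  \<comment> \<open>Relative to \<open>qpoch_inf x x\<close>, \<open>Q\<close> lacks exactly the
    exponents congruent to 4 or 6 modulo 10; in terms of \<open>q\<close> these give the two
    products of base \<open>q ^ 5\<close>.\<close>
  moreover have "qpoch_inf x x = Q * qpochs_inf [q ^ 2, q ^ 3] (q ^ 5)"
  proof -
    have "qpoch_inf x x = qpoch_inf x (x ^ 5) * qpoch_inf (x\<^sup>2) (x ^ 5) * qpoch_inf (x ^ 3) (x ^ 5)
        * qpoch_inf (x ^ 4) (x ^ 5) * qpoch_inf (x ^ 5) (x ^ 5)"
      by (subst qpoch_inf_split[OF x(1), of 5]) (simp_all add: eval_nat_numeral mult_ac)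
    also have "qpoch_inf x (x ^ 5) = qpoch_inf x (x ^ 10) * qpoch_inf (x ^ 6) (x ^ 10)"
      by (subst qpoch_inf_split[OF x5(1), of 2])
         (simp_all add: numeral_2_eq_2 flip: power_mult power_Suc)
    also have "qpoch_inf (x ^ 4) (x ^ 5) = qpoch_inf (x ^ 4) (x ^ 10) * qpoch_inf (x ^ 9) (x ^ 10)"
      by (subst qpoch_inf_split[OF x5(1), of 2])
         (simp_all add: numeral_2_eq_2 flip: power_mult power_add)
    finally show ?thesis
      by (simp add: Q_def qpochs_inf_def q mult_ac flip: power_mult)
  qed
  ultimately show ?thesis by simp
qed

text \<open>Both dissections of \<open>qpoch_inf x x\<close> hold for either square root of
  \<open>q\<close>, so their odd parts agree.\<close>

lemma theta_eq_product:
  assumes q: "norm q < 1" "q \<noteq> 0"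
  shows "quad_theta q 60 13 0 - quad_theta q 60 37 5 + quad_theta q 60 43 7 - quad_theta q 60 53 11
    = qpochs_inf [q ^ 3, q ^ 5, q ^ 8] (q ^ 8) * qpochs_inf [q ^ 2, q ^ 14] (q ^ 16)
      / qpochs_inf [q ^ 2, q ^ 3] (q ^ 5)" (is "?T = ?R / ?H")
proof -
  define x where "x = csqrt q"
  have x: "x\<^sup>2 = q" by (simp add: x_def)
  have "(norm x)\<^sup>2 < 1" using q(1) unfolding x[symmetric] norm_power .
  then have x0: "norm x < 1" "x \<noteq> 0"
    using q x by (auto simp: power_less_one_iff)
  have H: "?H \<noteq> 0"
    using q qpoch_inf_nonzero[of "q ^ 5" "q ^ k" for k]
    by (auto simp: qpochs_inf_def norm_power power_less_one_iff)
  define A where "A = (quad_theta q 60 7 0 + quad_theta q 60 23 2 - quad_theta q 60 17 1 - quad_theta q 60 47 9) * ?H"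
  define C where "C = quad_theta q 12 1 0 - quad_theta q 12 7 1"
  \<comment> \<open>\<open>A\<close>, \<open>C\<close>, \<open>?T\<close>, \<open>?H\<close> and
    \<open>?R\<close> depend on \<open>q\<close> alone, so \<open>y\<close> may be \<open>x\<close>
    or \<open>- x\<close>; subtracting the two instances cancels the even parts.\<close>
  have eq: "A - y * (?T * ?H) = C - y * ?R" if "norm y < 1" "y \<noteq> 0" "q = y\<^sup>2" for y
    using qpoch_inf_self_dissection[OF that] quintuple_product_5_2_dissection[OF that]
    unfolding A_def C_def quintuple_product_8_3[OF q] by (simp add: algebra_simps)
  have "(A - (- x) * (?T * ?H)) - (A - x * (?T * ?H)) = (C - (- x) * ?R) - (C - x * ?R)"
    using eq[of x] eq[of "- x"] x x0 by simp
  then have "?T * ?H = ?R" using x0 by (simp add: mult_ac)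
  then show ?thesis using H by (simp add: eq_divide_eq)
qed

subsection \<open>The indices of the series\<close>

text \<open>A set of naturals has only one increasing enumeration. In the induction one inequality
  suffices, by symmetry in \<open>f\<close> and \<open>g\<close>.\<close>

lemma strict_mono_eqI_range:
  fixes f g :: "nat \<Rightarrow> nat"
  assumes "strict_mono f" "strict_mono g" "range f = range g"
  shows "f n = g n"
proof (induction n rule: less_induct)
  case (less n)
  have "g' n \<le> f' n"
    if f': "strict_mono f'" and g': "strict_mono g'" and rng: "range f' = range g'"
      and eq: "\<And>m. m < n \<Longrightarrow> f' m = g' m"
    for f' g' :: "nat \<Rightarrow> nat"
  proof -
    obtain j where j: "f' n = g' j" using rng by (metis rangeE rangeI)
    \<comment> \<open>Otherwise \<open>f' j = g' j = f' n\<close> by the induction hypothesis,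
      against injectivity.\<close>
    have "\<not> j < n"
      using f' eq j by (metis less_irrefl strict_mono_eq)
    then show ?thesis using g' j by (simp add: strict_mono_less_eq)
  qed
  from this[of f g] this[of g f] show ?case using assms less by fastforce
qed

text \<open>The increasing list of the positive \<open>k\<close> with k^2 congruent to 169 modulo
  240. Such \<open>k\<close> form eight classes modulo 120, since (k + 120)^2 and k^2 agree modulo
  240.\<close>

definition sqrt_idx :: "nat \<Rightarrow> nat" where
  "sqrt_idx n = 120 * (n div 8) + [13, 37, 43, 53, 67, 77, 83, 107] ! (n mod 8)"

lemma nat_mod8_cases:
  fixes n :: nat
  obtains t i where "n = 8 * t + i" "i < 8"
  by (metis mult_div_mod_eq mod_less_divisor zero_less_numeral)

lemma sqrt_idx_block: "i < 8 \<Longrightarrow> sqrt_idx (8 * t + i) = 120 * t + [13, 37, 43, 53, 67, 77, 83, 107] ! i"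
  by (simp add: sqrt_idx_def)

lemma less_8_cases: "i < 8 \<Longrightarrow> i \<in> {0, 1, 2, 3, 4, 5, 6, 7}" for i :: nat
  by auto

lemma sqrt_idx_Suc: "sqrt_idx n < sqrt_idx (Suc n)"
proof -
  obtain t i where n: "n = 8 * t + i" "i < 8" by (rule nat_mod8_cases)
  show ?thesis
  proof (cases "i = 7")
    \<comment> \<open>At the end of a block the comparison is 107 < 120 + 13.\<close>
    case True
    then have "Suc n = 8 * Suc t + 0" using n by simp
    then show ?thesis
      using n sqrt_idx_block[of 0 "Suc t"] by (simp add: True sqrt_idx_block)
  next
    case False
    then have i: "Suc i < 8" using n by simp
    have "sqrt_idx (Suc n) = sqrt_idx (8 * t + Suc i)" using n by simp
    moreover have "[13, 37, 43, 53, 67, 77, 83, 107] ! i < ([13, 37, 43, 53, 67, 77, 83, 107] ! Suc i :: nat)"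
      using less_8_cases[OF n(2)] False by auto
    ultimately show ?thesis using n i by (simp only: sqrt_idx_block)
  qed
qed

text \<open>A finite check showing that the table of residues is complete.\<close>

lemma residues_square_169:
  assumes "r < 120" "r\<^sup>2 mod 240 = (169::nat)"
  shows "r \<in> set [13, 37, 43, 53, 67, 77, 83, 107]"
proof -
  have "list_all (\<lambda>r. r\<^sup>2 mod 240 = (169::nat) \<longrightarrow> r \<in> set [13, 37, 43, 53, 67, 77, 83, 107]) [2..<120]"
    by (simp add: upt_rec_numeral)
  moreover have "r \<noteq> 0" "r \<noteq> 1" using assms(2) by (intro notI; simp)+
  then have "r \<in> set [2..<120]" unfolding set_upt using assms(1) by simp
  ultimately show ?thesis using assms unfolding list_all_iff by blast
qed

text \<open>Truncated subtraction and division are exact here: every table entry is at least 13 and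
  has square congruent to 169 modulo 240.\<close>

lemma sqrt_idx_square: "240 * (((sqrt_idx n)\<^sup>2 - 169) div 240) + 169 = (sqrt_idx n)\<^sup>2"
proof -
  obtain t i where n: "n = 8 * t + i" "i < 8" by (rule nat_mod8_cases)
  define r :: nat where "r = [13, 37, 43, 53, 67, 77, 83, 107] ! i"
  have k: "sqrt_idx n = 120 * t + r" using n by (simp add: sqrt_idx_block r_def)
  have r: "r\<^sup>2 = 240 * ((r\<^sup>2 - 169) div 240) + 169"
    using less_8_cases[OF n(2)] by (auto simp: r_def)
  have "(sqrt_idx n)\<^sup>2 = 240 * (60 * t\<^sup>2 + t * r) + r\<^sup>2"
    by (simp add: k power2_eq_square algebra_simps)
  also have "\<dots> = 240 * (60 * t\<^sup>2 + t * r + (r\<^sup>2 - 169) div 240) + 169"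
    by (subst r) (simp add: algebra_simps)
  finally show ?thesis by simp
qed

lemma sqrt_idx_surj:
  assumes "240 * m + 169 = k\<^sup>2"
  shows "\<exists>n. sqrt_idx n = k"
proof -
  define t r where "t = k div 120" and "r = k mod 120"
  have k: "k = 120 * t + r" by (simp add: t_def r_def)
  have "k\<^sup>2 = 240 * (60 * t\<^sup>2 + t * r) + r\<^sup>2"
    by (simp add: k power2_eq_square algebra_simps)
  with assms have "240 * m + 169 = 240 * (60 * t\<^sup>2 + t * r) + r\<^sup>2" by simp
  then have "(240 * m + 169) mod 240 = (240 * (60 * t\<^sup>2 + t * r) + r\<^sup>2) mod 240" by (rule arg_cong)
  then have "r\<^sup>2 mod 240 = 169" unfolding mod_mult_self4 by simp
  moreover have "r < 120" by (simp add: r_def)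
  ultimately have "r \<in> set [13, 37, 43, 53, 67, 77, 83, 107]"
    by (rule residues_square_169[rotated])
  then obtain i where "i < length [13, 37, 43, 53, 67, 77, 83, 107 :: nat]"
      and i: "[13, 37, 43, 53, 67, 77, 83, 107] ! i = r"
    unfolding in_set_conv_nth by blast
  then have "i < 8" by simp
  with i have "sqrt_idx (8 * t + i) = k" by (simp only: sqrt_idx_block k)
  then show ?thesis ..
qed

text \<open>The numbers \<open>b n\<close> increase strictly and exhaust \<open>square_idx\<close>,
  so they are its enumeration.\<close>

lemma a_seq_eq: "240 * a_seq n + 169 = (sqrt_idx n)\<^sup>2"
proof -
  define b where "b n = ((sqrt_idx n)\<^sup>2 - 169) div 240" for n
  have b: "240 * b n + 169 = (sqrt_idx n)\<^sup>2" for n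
    unfolding b_def by (rule sqrt_idx_square)
  have mono: "strict_mono b"
  proof (rule strict_monoI_Suc)
    fix n
    have "(sqrt_idx n)\<^sup>2 < (sqrt_idx (Suc n))\<^sup>2"
      using sqrt_idx_Suc by (intro power_strict_mono) auto
    then show "b n < b (Suc n)" unfolding b[symmetric] by simp
  qed
  have "range b = square_idx"
  proof
    show "range b \<subseteq> square_idx"
      unfolding square_idx_def using b by blast
    show "square_idx \<subseteq> range b"
    proof
      fix m assume "m \<in> square_idx"
      then obtain k where "240 * m + 169 = k\<^sup>2" by (auto simp: square_idx_def)
      with sqrt_idx_surj obtain n where "240 * m + 169 = (sqrt_idx n)\<^sup>2" by metis
      with b[of n] have "m = b n" by simp
      then show "m \<in> range b" by simp
    qed
  qed
  then have "a_seq n = b n"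
    using strict_mono_a_seq mono range_a_seq by (intro strict_mono_eqI_range) auto
  with b show ?thesis by simp
qed

lemma sign_period: "(-1 :: complex) ^ nat \<lfloor>5 * real n / 4\<rfloor> = (-1) ^ (5 * (n mod 8) div 4)"
proof -
  have "\<lfloor>5 * real n / 4\<rfloor> = int (5 * n div 4)"
    using floor_divide_of_nat_eq[of "5 * n" 4, where ?'a = real] by simp
  \<comment> \<open>Raising \<open>n\<close> by 8 adds 10 to the floor, an even number, so the sign
    has period 8.\<close>
  moreover have "5 * n div 4 = 2 * (5 * (n div 8)) + 5 * (n mod 8) div 4"
  proof -
    have "5 * n = 5 * (n mod 8) + (10 * (n div 8)) * 4"
      using div_mult_mod_eq[of n 8] by linarith
    then show ?thesis by simp
  qed
  ultimately show ?thesis by (simp only: nat_int power_add power_mult) simp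
qed

text \<open>
  Enumerates the numbers \<open>n\<close> with \<open>n mod 8 \<in> {i, 7 - i}\<close> by the integers, in such a way that
  \<open>sqrt_idx\<close> becomes \<open>\<bar>120 j + r\<bar>\<close> for a fixed \<open>r\<close>.
\<close>

definition zigzag :: "nat \<Rightarrow> int \<Rightarrow> nat" where
  "zigzag i j = (if j \<ge> 0 then 8 * nat j + i else 8 * nat (- 1 - j) + (7 - i))"

text \<open>Nonnegative \<open>j\<close> cover residue \<open>i\<close>, negative \<open>j\<close>
  cover \<open>7 - i\<close>; these differ as their sum is odd.\<close>

lemma bij_betw_zigzag:
  assumes "i < 4"
  shows "bij_betw (zigzag i) UNIV {n. n mod 8 \<in> {i, 7 - i}}"
proof (rule bij_betwI[where g = "\<lambda>n. if n mod 8 = i then int (n div 8) else - 1 - int (n div 8)"])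
  fix n assume "n \<in> {n. n mod 8 \<in> {i, 7 - i}}"
  then have "n mod 8 = i \<or> n mod 8 \<noteq> i \<and> 7 - i = n mod 8" by auto
  then show "zigzag i (if n mod 8 = i then int (n div 8) else - 1 - int (n div 8)) = n"
    by (auto simp: zigzag_def)
qed (use assms in \<open>auto simp: zigzag_def simp del: Nat.add_diff_assoc\<close>)

text \<open>The table is symmetric: entries \<open>i\<close> and \<open>7 - i\<close> add up to 120,
  so a negative \<open>j\<close> yields \<open>- (120 * j + r)\<close>.\<close>

lemma sqrt_idx_zigzag:
  assumes "(i, r) \<in> {(0, 13), (1, 37), (2, 43), (3, 53)}"
  shows "int (sqrt_idx (zigzag i j)) = \<bar>120 * j + r\<bar>"
proof -
  have "i < 8" using assms by auto
  then have "sqrt_idx (zigzag i j) = (if j \<ge> 0 then 120 * nat j + [13, 37, 43, 53, 67, 77, 83, 107] ! i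
      else 120 * nat (- 1 - j) + [13, 37, 43, 53, 67, 77, 83, 107] ! (7 - i))"
    by (simp add: zigzag_def sqrt_idx_block del: Nat.add_diff_assoc)
  then show ?thesis using assms by auto
qed

text \<open>Here c = (r^2 - 169) / 240, from (120 j + r)^2 = 240 (60 j^2 + r j + c) + 169, and
  \<open>e\<close> is the sign shared by the residues \<open>i\<close> and
  \<open>7 - i\<close>.\<close>

lemma has_sum_residue_pair:
  fixes q :: complex
  assumes q: "norm q < 1" "q \<noteq> 0"
    and ir: "(i, r, c, e) \<in> {(0, 13, 0, 1), (1, 37, 5, -1), (2, 43, 7, 1), (3, 53, 11, -1)}"
  shows "((\<lambda>n. (-1) ^ nat \<lfloor>5 * real n / 4\<rfloor> * q ^ a_seq n) has_sum e * quad_theta q 60 r c)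
    {n. n mod 8 \<in> {i, 7 - i}}"
proof -
  have i: "i < 4" using ir by auto
  have "(-1) ^ nat \<lfloor>5 * real (zigzag i j) / 4\<rfloor> * q ^ a_seq (zigzag i j)
      = e * q powi (60 * j\<^sup>2 + r * j + c)" for j
  proof -
    have "(int (sqrt_idx (zigzag i j)))\<^sup>2 = (120 * j + r)\<^sup>2"
      using sqrt_idx_zigzag[of i r j] ir by auto
    then have "240 * int (a_seq (zigzag i j)) + 169 = (120 * j + r)\<^sup>2"
      using a_seq_eq[of "zigzag i j"] by (metis of_nat_add of_nat_mult of_nat_numeral of_nat_power)
    then have "int (a_seq (zigzag i j)) = 60 * j\<^sup>2 + r * j + c"
      using ir by (auto simp: power2_eq_square algebra_simps)
    then have "q ^ a_seq (zigzag i j) = q powi (60 * j\<^sup>2 + r * j + c)"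
      by (metis power_int_of_nat)
    moreover have "zigzag i j mod 8 \<in> {i, 7 - i}"
      using bij_betwE[OF bij_betw_zigzag[OF i]] by blast
    then have "(-1 :: complex) ^ nat \<lfloor>5 * real (zigzag i j) / 4\<rfloor> = e"
      unfolding sign_period using ir by auto
    ultimately show ?thesis by simp
  qed
  moreover have "((\<lambda>j. e * q powi (60 * j\<^sup>2 + r * j + c)) has_sum e * quad_theta q 60 r c) UNIV"
    by (intro has_sum_cmult_right has_sum_quad_theta q) simp
  ultimately show ?thesis
    by (subst has_sum_reindex_bij_betw[OF bij_betw_zigzag[OF i], symmetric]) simp
qed

theorem theorem10:
  fixes q :: complex
  assumes "norm q < 1"
  shows "(\<lambda>n. (-1) ^ nat \<lfloor>5 * real n / 4\<rfloor> * q ^ a_seq n) sums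
    (qpochs_inf [q ^ 3, q ^ 5, q ^ 8] (q ^ 8) * qpochs_inf [q ^ 2, q ^ 14] (q ^ 16)
      / qpochs_inf [q ^ 2, q ^ 3] (q ^ 5))"
proof (cases "q = 0")
  case True
  \<comment> \<open>At \<open>q = 0\<close> only the term \<open>n = 0\<close> survives, with
    \<open>0 ^ 0 = 1\<close>, and every product is 1.\<close>
  have "a_seq 0 = 0" using a_seq_eq[of 0] by (simp add: sqrt_idx_def)
  then have "a_seq n = 0 \<longleftrightarrow> n = 0" for n
    using strict_mono_a_seq by (metis strict_mono_eq)
  then have "(\<lambda>n. (-1) ^ nat \<lfloor>5 * real n / 4\<rfloor> * q ^ a_seq n) = (\<lambda>n. if n = 0 then 1 else 0)"
    by (auto simp: True fun_eq_iff power_0_left)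
  then show ?thesis
    using sums_single[of 0 "\<lambda>_. 1 :: complex"] by (simp add: True qpochs_inf_def qpoch_inf_def)
next
  case False
  let ?f = "\<lambda>n. (-1) ^ nat \<lfloor>5 * real n / 4\<rfloor> * q ^ a_seq n"
  let ?B = "\<lambda>i. {n. n mod 8 \<in> {i, 7 - i :: nat}}"
  note pair = has_sum_residue_pair[OF assms False]
  \<comment> \<open>The four residue pairs partition the naturals and give the four thetas of the
    odd part.\<close>
  have "(?f has_sum 1 * quad_theta q 60 13 0 + (-1) * quad_theta q 60 37 5
      + 1 * quad_theta q 60 43 7 + (-1) * quad_theta q 60 53 11) (?B 0 \<union> ?B 1 \<union> ?B 2 \<union> ?B 3)"
    by (intro has_sum_Un_disjoint pair) auto
  also have "?B 0 \<union> ?B 1 \<union> ?B 2 \<union> ?B 3 = UNIV"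
  proof -
    have "n \<in> ?B 0 \<union> ?B 1 \<union> ?B 2 \<union> ?B 3" for n
      using less_8_cases[of "n mod 8"] by auto
    then show ?thesis by blast
  qed
  finally show ?thesis
    using theta_eq_product[OF assms False] has_sum_imp_sums by fastforce
qed

end
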